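(* Let $N\ge1$, $s,t\in(0,1)$, $p,q\in(1,\infty)$ with $\frac{sp}{p-1}\geq\frac{tq}{q-1}$, and let $\Gamma=\min\left(1,\frac{sp}{p-1}\right)$. Assume that one of the following alternatives holds: (1) $1<q\leq 2\leq p$; (2) $1<p\leq 2\leq q$ and $sp\geq tq$; (3) $p,q\in(1,2]$. Let $u\in W^{s,p}(\mathbb{R}^N)\cap L_{sp}^{p-1}(\mathbb{R}^N)\cap W^{t,q}(\mathbb{R}^N)\cap L_{tq}^{q-1}(\mathbb{R}^N)$ be a globally bounded local weak solution of $$(-\Delta_p)^su+(-\Delta_q)^tu=0\quad\text{in }\mathbb{R}^N .$$ Assume in addition that $\beta(sp-tq)<\Gamma$, where $\beta=\beta(N,s,p,t,q,\varepsilon)\ge1$ is, for some $\varepsilon\in(0,\Gamma)$, the exponent in the interior Hölder estimate recalled in the context. Then $u$ is constant in $\mathbb{R}^N$.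
   Context: Notation. $B_r(x_0)\subset\mathbb{R}^N$ is the ball of radius $r$ centered at $x_0$. For $0<\delta\le1$, $[u]_{C^\delta(E)}=\sup_{x\ne y\in E}\frac{|u(x)-u(y)|}{|x-y|^\delta}$. For $0<\beta<1<l<\infty$ and $\Omega$ open, $W^{\beta,l}(\Omega)$ is the set of $\psi\in L^l(\Omega)$ with $\iint_{\Omega\times\Omega}\frac{|\psi(x)-\psi(y)|^l}{|x-y|^{N+\beta l}}\,dx\,dy<\infty$; $W^{\beta,l}_{\mathrm{loc}}(\Omega)$ is its local version. Tail space: for $l>0,\alpha>0$, $L^l_\alpha(\mathbb{R}^N)=\{u\in L^l_{\rm loc}(\mathbb{R}^N):\int_{\mathbb{R}^N}\frac{|u(x)|^l}{1+|x|^{N+\alpha}}dx<\infty\}$, and $\mathrm{Tail}_{l,\alpha}(u;x_0,R)=\left[R^\alpha\int_{\mathbb{R}^N\setminus B_R(x_0)}\frac{|u(x)|^l}{|x-x_0|^{N+\alpha}}\,dx\right]^{1/l}$. Local weak solution (in an open set $\Omega$, here $\Omega=\mathbb{R}^N$ or $\Omega$ bounded): $u\in W^{s,p}_{\mathrm{loc}}(\Omega)\cap L_{sp}^{p-1}(\mathbb{R}^N)\cap W^{t,q}_{\mathrm{loc}}(\Omega)\cap L_{tq}^{q-1}(\mathbb{R}^N)$ is a local weak solution of $(-\Delta_p)^su+(-\Delta_q)^tu=0$ in $\Omega$ if $$\iint_{\mathbb{R}^N\times\mathbb{R}^N}\frac{J_p(u(x)-u(y))(\varphi(x)-\varphi(y))}{|x-y|^{N+sp}}dxdy+\iint_{\mathbb{R}^N\times\mathbb{R}^N}\frac{J_q(u(x)-u(y))(\varphi(x)-\varphi(y))}{|x-y|^{N+tq}}dxdy=0$$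 for every $\varphi\in W^{s,p}(\Omega)\cap W^{t,q}(\Omega)$ with compact support in $\Omega$, where $J_l(\tau)=|\tau|^{l-2}\tau$. The exponent $\beta$: under any of the alternatives (1)–(3) together with $\frac{sp}{p-1}\ge\frac{tq}{q-1}$, for every $0<\varepsilon<\Gamma$ there are constants $C=C(N,p,q,s,t,\varepsilon)>0$, $\sigma=\sigma(s,p,t,q,\varepsilon)>0$ and $\beta=\beta(N,s,p,t,q,\varepsilon)\ge1$ such that every local weak solution $u$ in an open bounded set $\Omega$ satisfies, for every $r>0$ and $x_0$ with $B_{2r}(x_0)\Subset\Omega$, $$[u]_{C^{\Gamma-\varepsilon}(B_{\sigma r}(x_0))}\le\frac{C(1+r^{sp-tq}\mathcal{M}_r^{q-p})^\beta}{r^{\Gamma-\varepsilon}}\mathcal{M}_r,\qquad \mathcal{M}_r=\|u\|_{L^\infty(B_r(x_0))}+\mathrm{Tail}_{p-1,sp}(u;x_0,r)+\mathrm{Tail}_{q-1,tq}(u;x_0,r)+1 .$$ The $\beta$ in the claim is this exponent. *)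

theory Defs
  imports "HOL-Analysis.Analysis" "HOL-Probability.Essential_Supremum"
begin

text \<open>
  The ambient space is an arbitrary Euclidean space \<open>'a\<close>, of dimension \<open>N = DIM('a)\<close>. Elements of
  function spaces are represented by Lebesgue measurable functions, not by classes modulo
  almost-everywhere equality. Since \<open>0 powr b = 0\<close> and \<open>x / 0 = 0\<close>, singular kernels vanish at their
  singularity, which is in each case a null set.
\<close>

definition holder_seminorm :: "'a::euclidean_space set \<Rightarrow> real \<Rightarrow> ('a \<Rightarrow> real) \<Rightarrow> ennreal" where
  "holder_seminorm E \<delta> u =
     (SUP (x, y) \<in> {(x, y). x \<in> E \<and> y \<in> E \<and> x \<noteq> y}. ennreal (\<bar>u x - u y\<bar> / norm (x - y) powr \<delta>))"

definition frac_sobolev :: "'a::euclidean_space set \<Rightarrow> real \<Rightarrow> real \<Rightarrow> ('a \<Rightarrow> real) set" where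
  "frac_sobolev \<Omega> \<beta> l = {\<psi>.
     \<psi> \<in> borel_measurable (lebesgue_on \<Omega>) \<and>
     set_integrable lebesgue \<Omega> (\<lambda>x. \<bar>\<psi> x\<bar> powr l) \<and>
     set_integrable lebesgue (\<Omega> \<times> \<Omega>)
       (\<lambda>(x, y). \<bar>\<psi> x - \<psi> y\<bar> powr l / norm (x - y) powr (real DIM('a) + \<beta> * l))}"

definition frac_sobolev_loc :: "'a::euclidean_space set \<Rightarrow> real \<Rightarrow> real \<Rightarrow> ('a \<Rightarrow> real) set" where
  "frac_sobolev_loc \<Omega> \<beta> l = {\<psi>.
     \<forall>U. open U \<and> bounded U \<and> closure U \<subseteq> \<Omega> \<longrightarrow> \<psi> \<in> frac_sobolev U \<beta> l}"

definition tail_space :: "real \<Rightarrow> real \<Rightarrow> ('a::euclidean_space \<Rightarrow> real) set" where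
  "tail_space l \<alpha> = {u.
     u \<in> borel_measurable lebesgue \<and>
     (\<forall>K. compact K \<longrightarrow> set_integrable lebesgue K (\<lambda>x. \<bar>u x\<bar> powr l)) \<and>
     integrable lebesgue (\<lambda>x. \<bar>u x\<bar> powr l / (1 + norm x powr (real DIM('a) + \<alpha>)))}"

definition tail :: "real \<Rightarrow> real \<Rightarrow> ('a::euclidean_space \<Rightarrow> real) \<Rightarrow> 'a \<Rightarrow> real \<Rightarrow> real" where
  "tail l \<alpha> u x\<^sub>0 R =
     (R powr \<alpha> * set_lebesgue_integral lebesgue (- ball x\<^sub>0 R)
        (\<lambda>x. \<bar>u x\<bar> powr l / norm (x - x\<^sub>0) powr (real DIM('a) + \<alpha>))) powr (1 / l)"

definition J :: "real \<Rightarrow> real \<Rightarrow> real" where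
  "J l \<tau> = \<bar>\<tau>\<bar> powr (l - 2) * \<tau>"

definition frac_form ::
    "real \<Rightarrow> real \<Rightarrow> ('a::euclidean_space \<Rightarrow> real) \<Rightarrow> ('a \<Rightarrow> real) \<Rightarrow> real" where
  "frac_form s p u \<phi> = integral\<^sup>L (lebesgue :: ('a \<times> 'a) measure)
     (\<lambda>(x, y). J p (u x - u y) * (\<phi> x - \<phi> y) / norm (x - y) powr (real DIM('a) + s * p))"

text \<open>
  A test function vanishes off a compact subset of \<open>\<Omega>\<close>, so it comes extended by zero to the whole
  space. For \<open>u\<close> and \<open>\<phi>\<close> as below both integrands are integrable (by Hoelder's inequality near the
  support of \<open>\<phi>\<close>, and by the tail condition away from it), so the default value 0 of the integral of
  a non-integrable function plays no role.
\<close>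

definition local_weak_solution ::
    "'a::euclidean_space set \<Rightarrow> real \<Rightarrow> real \<Rightarrow> real \<Rightarrow> real \<Rightarrow> ('a \<Rightarrow> real) \<Rightarrow> bool" where
  "local_weak_solution \<Omega> s p t q u \<longleftrightarrow>
     u \<in> frac_sobolev_loc \<Omega> s p \<inter> tail_space (p - 1) (s * p) \<and>
     u \<in> frac_sobolev_loc \<Omega> t q \<inter> tail_space (q - 1) (t * q) \<and>
     (\<forall>\<phi> \<in> frac_sobolev \<Omega> s p \<inter> frac_sobolev \<Omega> t q.
        (\<exists>K. compact K \<and> K \<subseteq> \<Omega> \<and> (\<forall>x. x \<notin> K \<longrightarrow> \<phi> x = 0)) \<longrightarrow>
        frac_form s p u \<phi> + frac_form t q u \<phi> = 0)"

definition Linf_norm_on :: "'a::euclidean_space set \<Rightarrow> ('a \<Rightarrow> real) \<Rightarrow> ereal" where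
  "Linf_norm_on E u = esssup (lebesgue_on E) (\<lambda>x. ereal \<bar>u x\<bar>)"

definition M_quantity ::
    "real \<Rightarrow> real \<Rightarrow> real \<Rightarrow> real \<Rightarrow> ('a::euclidean_space \<Rightarrow> real) \<Rightarrow> 'a \<Rightarrow> real \<Rightarrow> real" where
  "M_quantity s p t q u x\<^sub>0 r =
     real_of_ereal (Linf_norm_on (ball x\<^sub>0 r) u)
       + tail (p - 1) (s * p) u x\<^sub>0 r + tail (q - 1) (t * q) u x\<^sub>0 r + 1"

definition Gamma_exp :: "real \<Rightarrow> real \<Rightarrow> real" where
  "Gamma_exp s p = min 1 (s * p / (p - 1))"

text \<open>
  \<open>\<beta>\<close> is an admissible exponent in the interior Hoelder estimate at level \<open>\<epsilon>\<close> on the space \<open>'a\<close>. The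
  constants \<open>C\<close> and \<open>\<sigma>\<close> are uniform in \<open>\<Omega>\<close>, \<open>u\<close>, \<open>r\<close> and \<open>x\<^sub>0\<close>. The estimate concerns the class of
  \<open>u\<close> modulo almost-everywhere equality, hence the representative \<open>v\<close>. If \<open>u\<close> is not essentially
  bounded on the ball of radius \<open>r\<close>, the right-hand side is infinite and nothing is asserted.
\<close>

definition interior_holder_exponent ::
    "'a::euclidean_space itself \<Rightarrow> real \<Rightarrow> real \<Rightarrow> real \<Rightarrow> real \<Rightarrow> real \<Rightarrow> real \<Rightarrow> bool" where
  "interior_holder_exponent _ s p t q \<epsilon> \<beta> \<longleftrightarrow> \<beta> \<ge> 1 \<and>
     (\<exists>C > 0. \<exists>\<sigma> > 0. \<forall>(\<Omega> :: 'a set) u x\<^sub>0 r.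
        open \<Omega> \<and> bounded \<Omega> \<and> local_weak_solution \<Omega> s p t q u \<and>
        r > 0 \<and> closure (ball x\<^sub>0 (2 * r)) \<subseteq> \<Omega> \<and> Linf_norm_on (ball x\<^sub>0 r) u < \<infinity> \<longrightarrow>
        (\<exists>v. (AE x in lebesgue. x \<in> ball x\<^sub>0 (\<sigma> * r) \<longrightarrow> v x = u x) \<and>
             holder_seminorm (ball x\<^sub>0 (\<sigma> * r)) (Gamma_exp s p - \<epsilon>) v
               \<le> ennreal (C * (1 + r powr (s * p - t * q) * M_quantity s p t q u x\<^sub>0 r powr (q - p)) powr \<beta>
                     / r powr (Gamma_exp s p - \<epsilon>) * M_quantity s p t q u x\<^sub>0 r)))"

end

theory Submission
  imports Defs
begin

text \<open>
  The theorem is an energy identity. If the weak formulation could be tested with \<open>u\<close> itself, it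
  would read \<open>[u]\<^sub>s\<^sub>,\<^sub>p + [u]\<^sub>t\<^sub>,\<^sub>q = 0\<close>, where
  \<open>[u]\<^sub>s\<^sub>,\<^sub>p\<close> is the double integral of \<open>\<bar>u x - u y\<bar> powr p / norm (x - y) powr (N + s * p)\<close>,
  because \<open>J p \<tau> * \<tau> = \<bar>\<tau>\<bar> powr p\<close>. Both terms are nonnegative, so both vanish; then \<open>u x = u y\<close>
  for almost every pair \<open>(x, y)\<close>, and by Fubini \<open>u\<close> is almost everywhere constant.

  Since \<open>u\<close> need not have compact support, it is replaced by \<open>u * \<eta>\<^sub>n\<close>, with cutoffs \<open>\<eta>\<^sub>n\<close> that
  have values in \<open>[0, 1]\<close>, are 1-Lipschitz, and increase to 1. Two points make this work. These
  products are admissible (\<open>frac_sobolev_cutoff\<close>), and the forms pass to the limit by dominated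
  convergence (\<open>frac_form_cutoff_tendsto\<close>). Both rest on the same bound, uniform in \<open>n\<close>: the increment
  of \<open>u * \<eta>\<^sub>n\<close> between \<open>x\<close> and \<open>y\<close> is at most \<open>\<bar>u x - u y\<bar> + \<bar>u x\<bar> * min 1 (norm (x - y))\<close>. The
  first term is controlled by the energy of \<open>u\<close>. The second leads to the integrand
  \<open>\<bar>u x\<bar> powr p * k (x - y)\<close> with \<open>k h = min 1 (norm h) powr p / norm h powr (N + s * p)\<close>. As
  \<open>0 < s < 1\<close>, this kernel is integrable both at the origin and at infinity
  (\<open>integrable_cutoff_kernel\<close>), and \<open>u\<close> is in \<open>L\<^sup>p\<close> of the whole space.
\<close>

section \<open>Integrability of radial powers over geometric annuli\<close>

text \<open>
  The annulus of radius \<open>\<rho> ^ j\<close> has volume comparable to \<open>\<rho> ^ (j * N)\<close>, and the power is there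
  comparable to \<open>(\<rho> ^ j) powr c\<close>, so the integral is dominated by a geometric series of ratio
  \<open>\<rho> powr (c + N)\<close>. The case \<open>\<rho> = 2\<close> treats the behaviour at infinity, the case \<open>\<rho> = 1/2\<close> the
  behaviour at the origin.
\<close>

lemma nn_integral_norm_powr_annuli_finite:
  fixes \<rho> c :: real
  assumes \<rho>: "0 < \<rho>" and small: "\<rho> powr (c + DIM('a)) < 1"
  shows "(\<integral>\<^sup>+h. ennreal (norm h powr c) *
            indicator (\<Union>j::nat. {h. \<rho> ^ j \<le> norm h \<and> norm h \<le> 2 * \<rho> ^ j}) h
          \<partial>(lborel :: 'a::euclidean_space measure)) < \<infinity>"
proof -
  define \<theta> where "\<theta> = \<rho> powr (c + DIM('a))"
  define A where "A j = {h::'a. \<rho> ^ j \<le> norm h \<and> norm h \<le> 2 * \<rho> ^ j}" for j :: nat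
  define b where "b j = 2 powr \<bar>c\<bar> * (\<rho> ^ j) powr c" for j :: nat
  \<comment> \<open>The factor \<open>2 powr \<bar>c\<bar>\<close> covers both signs of \<open>c\<close>, that is, a maximum at either boundary.\<close>
  have bnd: "norm h powr c \<le> b j" if h: "h \<in> A j" for h j
  proof (cases "c \<ge> 0")
    case True
    have "norm h powr c \<le> (2 * \<rho> ^ j) powr c"
      using h True by (intro powr_mono2) (auto simp: A_def)
    thus ?thesis using True \<rho> by (simp add: b_def powr_mult)
  next
    case False
    have "norm h powr c \<le> (\<rho> ^ j) powr c"
      using h False \<rho> by (intro powr_mono2') (auto simp: A_def)
    also have "\<dots> \<le> b j"
      using mult_right_mono[of 1 "2 powr \<bar>c\<bar>" "(\<rho> ^ j) powr c"]
      by (simp add: b_def ge_one_powr_ge_zero)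
    finally show ?thesis .
  qed
  have "(\<integral>\<^sup>+h. ennreal (norm h powr c) * indicator (\<Union>j. A j) h \<partial>lborel)
        \<le> (\<integral>\<^sup>+h. (\<Sum>j. ennreal (b j) * indicator (cball 0 (2 * \<rho> ^ j)) h) \<partial>(lborel :: 'a measure))"
  proof (rule nn_integral_mono)
    fix h :: 'a
    show "ennreal (norm h powr c) * indicator (\<Union>j. A j) h
          \<le> (\<Sum>j. ennreal (b j) * indicator (cball 0 (2 * \<rho> ^ j)) h)"
    proof (cases "h \<in> (\<Union>j. A j)")
      case True
      then obtain j where j: "h \<in> A j" by auto
      have "ennreal (norm h powr c) * indicator (\<Union>j. A j) h \<le> ennreal (b j)"
        using True bnd[OF j] by (simp add: ennreal_leI)
      also have "\<dots> = (\<Sum>i\<in>{j}. ennreal (b i) * indicator (cball 0 (2 * \<rho> ^ i)) h)"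
        using j by (auto simp: A_def)
      also have "\<dots> \<le> (\<Sum>i. ennreal (b i) * indicator (cball 0 (2 * \<rho> ^ i)) h)"
        by (rule sum_le_suminf) auto
      finally show ?thesis .
    qed auto
  qed
  also have "\<dots> = (\<Sum>j. ennreal (b j) * emeasure lborel (cball (0::'a) (2 * \<rho> ^ j)))"
    by (subst nn_integral_suminf)
       (auto simp: nn_integral_cmult_indicator intro!: borel_measurable_times_ennreal borel_measurable_indicator)
  also have "\<dots> = (\<Sum>j. ennreal (2 powr \<bar>c\<bar> * unit_ball_vol (real DIM('a)) * 2 ^ DIM('a) * \<theta> ^ j))"
  proof (rule suminf_cong)
    fix j :: nat
    have "(\<rho> ^ j) powr c * (\<rho> ^ j) ^ DIM('a) = (\<rho> ^ j) powr (c + DIM('a))"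
      using \<rho> by (simp add: powr_add powr_realpow)
    also have "\<dots> = \<theta> ^ j"
      using \<rho> by (simp add: \<theta>_def powr_powr mult.commute flip: powr_realpow)
    finally have *: "(\<rho> ^ j) powr c * (\<rho> ^ j) ^ DIM('a) = \<theta> ^ j" .
    have "b j * (unit_ball_vol (real DIM('a)) * (2 * \<rho> ^ j) ^ DIM('a)) =
        2 powr \<bar>c\<bar> * unit_ball_vol (real DIM('a)) * 2 ^ DIM('a) * ((\<rho> ^ j) powr c * (\<rho> ^ j) ^ DIM('a))"
      by (simp add: b_def power_mult_distrib mult_ac)
    also have "\<dots> = 2 powr \<bar>c\<bar> * unit_ball_vol (real DIM('a)) * 2 ^ DIM('a) * \<theta> ^ j"
      by (simp only: *)
    finally have **: "b j * (unit_ball_vol (real DIM('a)) * (2 * \<rho> ^ j) ^ DIM('a)) =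
        2 powr \<bar>c\<bar> * unit_ball_vol (real DIM('a)) * 2 ^ DIM('a) * \<theta> ^ j" .
    have "emeasure lborel (cball (0::'a) (2 * \<rho> ^ j)) =
        ennreal (unit_ball_vol (real DIM('a)) * (2 * \<rho> ^ j) ^ DIM('a))"
      using \<rho> by (intro emeasure_cball) simp
    thus "ennreal (b j) * emeasure lborel (cball (0::'a) (2 * \<rho> ^ j)) =
        ennreal (2 powr \<bar>c\<bar> * unit_ball_vol (real DIM('a)) * 2 ^ DIM('a) * \<theta> ^ j)"
      unfolding **[symmetric] using \<rho> by (simp only: ennreal_mult b_def) (simp add: ennreal_mult)
  qed
  also have "\<dots> < \<infinity>"
  proof -
    have "summable (\<lambda>j. \<theta> ^ j)"
      using small by (intro summable_geometric) (auto simp: \<theta>_def)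
    hence "summable (\<lambda>j. 2 powr \<bar>c\<bar> * unit_ball_vol (real DIM('a)) * 2 ^ DIM('a) * \<theta> ^ j)"
      by (rule summable_mult)
    thus ?thesis by (subst suminf_ennreal2) (auto simp: \<theta>_def)
  qed
  finally show ?thesis by (simp add: A_def)
qed

lemma exists_power_two_annulus:
  fixes r :: real
  assumes "1 \<le> r"
  shows "\<exists>j::nat. 2 ^ j \<le> r \<and> r \<le> 2 * 2 ^ j"
proof -
  obtain n where "r < 2 ^ n" using real_arch_pow[of 2 r] by auto
  define j where "j = (LEAST n. r < 2 ^ n)"
  have j: "r < 2 ^ j" unfolding j_def by (rule LeastI) fact
  have "j \<noteq> 0" using j assms by (cases j) auto
  hence "\<not> r < 2 ^ (j - 1)" unfolding j_def by (intro not_less_Least) auto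
  moreover have "2 * 2 ^ (j - 1) = (2::real) ^ j"
    using \<open>j \<noteq> 0\<close> by (cases j) auto
  ultimately show ?thesis using j by (intro exI[of _ "j - 1"]) auto
qed

text \<open>
  Near the origin the kernel is the power of exponent \<open>p - s * p - N > - N\<close>, which is where \<open>s < 1\<close>
  enters; outside the unit ball it is the power of exponent \<open>- s * p - N < - N\<close>, because \<open>s > 0\<close>.
\<close>

lemma integrable_cutoff_kernel:
  fixes s p :: real
  assumes s: "0 < s" "s < 1" and p: "0 < p"
  shows "integrable lborel (\<lambda>h::'a::euclidean_space.
           min 1 (norm h) powr p / norm h powr (real DIM('a) + s * p))"
proof (rule integrableI_bounded)
  let ?c = "p - s * p - DIM('a)" and ?d = "- (s * p) - DIM('a)"
  let ?A = "\<lambda>\<rho>. \<Union>j::nat. {h::'a. \<rho> ^ j \<le> norm h \<and> norm h \<le> 2 * \<rho> ^ j}"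
  have sp: "s * p < p" "0 < s * p" using s p by auto
  have meas [measurable]: "?A \<rho> \<in> sets borel" for \<rho> by measurable
  show "(\<lambda>h::'a. min 1 (norm h) powr p / norm h powr (real DIM('a) + s * p)) \<in> borel_measurable lborel"
    by measurable
  have "(\<integral>\<^sup>+h. ennreal (norm (min 1 (norm h) powr p / norm h powr (real DIM('a) + s * p))) \<partial>(lborel::'a measure))
    \<le> (\<integral>\<^sup>+h. ennreal (norm h powr ?c) * indicator (?A (1/2)) h +
             ennreal (norm h powr ?d) * indicator (?A 2) h \<partial>lborel)"
  proof (rule nn_integral_mono)
    fix h :: 'a
    show "ennreal (norm (min 1 (norm h) powr p / norm h powr (real DIM('a) + s * p)))
       \<le> ennreal (norm h powr ?c) * indicator (?A (1/2)) h + ennreal (norm h powr ?d) * indicator (?A 2) h"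
    proof (cases "h = 0")
      case False
      show ?thesis
      proof (cases "1 \<le> norm h")
        case True
        have "h \<in> ?A 2" using exists_power_two_annulus[OF True] by auto
        moreover have "min 1 (norm h) powr p / norm h powr (real DIM('a) + s * p) = norm h powr ?d"
          using True by (simp add: powr_minus[symmetric] divide_inverse algebra_simps)
        ultimately show ?thesis by simp
      next
        case l: False
        \<comment> \<open>Inversion turns the annuli growing from radius 1 into those shrinking to the origin; the
          numerator 2 makes their inner and outer radii match.\<close>
        obtain j where j: "2 ^ j \<le> 2 / norm h" "2 / norm h \<le> 2 * 2 ^ j"
          using exists_power_two_annulus[of "2 / norm h"] l False by (auto simp: field_simps)
        have "h \<in> ?A (1/2)" using j False by (auto simp: field_simps intro!: exI[of _ j])
        moreover have "min 1 (norm h) powr p / norm h powr (real DIM('a) + s * p) = norm h powr ?c"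
          using l by (simp add: powr_diff[symmetric] algebra_simps)
        ultimately show ?thesis by simp
      qed
    qed auto
  qed
  also have "\<dots> = (\<integral>\<^sup>+h. ennreal (norm h powr ?c) * indicator (?A (1/2)) h \<partial>lborel) +
             (\<integral>\<^sup>+h. ennreal (norm h powr ?d) * indicator (?A 2) h \<partial>lborel)"
    by (rule nn_integral_add) auto
  also have "\<dots> < \<infinity>"
  proof -
    have "(1/2) powr (?c + DIM('a)) < (1::real)"
      using sp powr_less_one[of 2 "- (p - s*p)"] by (simp add: powr_minus_divide powr_divide)
    moreover have "2 powr (?d + DIM('a)) < (1::real)"
      using sp by (intro powr_less_one) auto
    ultimately show ?thesis
      using nn_integral_norm_powr_annuli_finite[where \<rho>="1/2" and c="?c" and 'a='a]
            nn_integral_norm_powr_annuli_finite[where \<rho>=2 and c="?d" and 'a='a]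
      by simp
  qed
  finally show "(\<integral>\<^sup>+h. ennreal (norm (min 1 (norm h) powr p / norm h powr (real DIM('a) + s * p))) \<partial>(lborel::'a measure)) < \<infinity>" .
qed

section \<open>Lebesgue measurability and integrability on the product space\<close>

text \<open>
  The Lebesgue measure on a product is the completion of the product of the Borel-Lebesgue
  measures, not a product measure, so Fubini's theorem reaches it only through Borel
  representatives. The next lemma makes changing the representative in one factor harmless.
\<close>

lemma AE_lebesgue_fst_snd:
  fixes P :: "'a::euclidean_space \<Rightarrow> bool"
  assumes "AE x in lebesgue. P x"
  shows "AE z in (lebesgue :: ('a \<times> 'a) measure). P (fst z) \<and> P (snd z)"
proof -
  have "AE x in lborel. P x" using assms by (simp add: AE_completion_iff)
  then obtain N where N: "N \<in> null_sets lborel" "{x. \<not> P x} \<subseteq> N"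
    by (auto simp: eventually_ae_filter)
  have "N \<times> UNIV \<union> UNIV \<times> N \<in> null_sets (lborel \<Otimes>\<^sub>M lborel :: ('a \<times> 'a) measure)"
    using N(1) by (intro null_sets.Un lborel.times_in_null_sets1 lborel.times_in_null_sets2) auto
  hence "AE z in (lborel \<Otimes>\<^sub>M lborel :: ('a \<times> 'a) measure). P (fst z) \<and> P (snd z)"
    by (rule AE_I') (use N(2) in \<open>auto simp: mem_Times_iff\<close>)
  thus ?thesis unfolding lborel_prod by (rule AE_completion)
qed

lemma lebesgue_measurable_fst_snd:
  fixes u :: "'a::euclidean_space \<Rightarrow> real"
  assumes "u \<in> borel_measurable lebesgue"
  shows "(\<lambda>z. u (fst z)) \<in> borel_measurable (lebesgue :: ('a \<times> 'a) measure)"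
    and "(\<lambda>z. u (snd z)) \<in> borel_measurable (lebesgue :: ('a \<times> 'a) measure)"
proof -
  obtain v where v: "v \<in> borel_measurable lborel" "AE x in lborel. u x = v x"
    using completion_ex_borel_measurable_real[OF assms] by auto
  have ae: "AE z in (lebesgue :: ('a \<times> 'a) measure). u (fst z) = v (fst z) \<and> u (snd z) = v (snd z)"
    using AE_lebesgue_fst_snd[of "\<lambda>x. u x = v x"] v(2) by (simp add: AE_completion_iff)
  have [measurable]: "v \<in> borel_measurable borel" using v(1) by simp
  have v_meas: "(\<lambda>z::'a \<times> 'a. v (fst z)) \<in> borel_measurable lebesgue"
       "(\<lambda>z::'a \<times> 'a. v (snd z)) \<in> borel_measurable lebesgue"
    by (auto intro!: measurable_completion simp: borel_prod[symmetric])
  show "(\<lambda>z. u (fst z)) \<in> borel_measurable (lebesgue :: ('a \<times> 'a) measure)"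
    by (rule borel_measurable_AE[OF v_meas(1)]) (use ae in \<open>auto elim: eventually_mono\<close>)
  show "(\<lambda>z. u (snd z)) \<in> borel_measurable (lebesgue :: ('a \<times> 'a) measure)"
    by (rule borel_measurable_AE[OF v_meas(2)]) (use ae in \<open>auto elim: eventually_mono\<close>)
qed

text \<open>
  By Fubini and translation invariance the integral of the absolute value is the product of the
  \<open>L\<^sup>1\<close> norms, as for a convolution.
\<close>

lemma integrable_lebesgue_convolution_integrand:
  fixes f g :: "'a::euclidean_space \<Rightarrow> real"
  assumes f: "integrable lebesgue f" and g: "integrable lborel g"
  shows "integrable (lebesgue :: ('a \<times> 'a) measure) (\<lambda>(x, y). f x * g (x - y))"
proof -
  obtain f' where f': "f' \<in> borel_measurable lborel" and eq: "AE x in lborel. f x = f' x"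
    using completion_ex_borel_measurable_real[OF borel_measurable_integrable[OF f]] by auto
  have "integrable lebesgue f'"
    using f by (subst integrable_cong_AE[symmetric, where f=f])
      (use eq f' in \<open>auto simp: AE_completion_iff intro: measurable_completion\<close>)
  hence if': "integrable lborel f'" using f' by (simp add: integrable_completion)
  have [measurable]: "f' \<in> borel_measurable borel" "g \<in> borel_measurable borel"
    using f' borel_measurable_integrable[OF g] by auto
  have gt: "integrable lborel (\<lambda>y. g (x - y))" "(\<integral>y. norm (g (x - y)) \<partial>lborel) = (\<integral>y. norm (g y) \<partial>lborel)" for x
  proof -
    have d: "distr lborel borel (\<lambda>y. x - y) = (lborel :: 'a measure)"
      using lborel_affine[of "-1" x] by (simp add: density_1)
    show "integrable lborel (\<lambda>y. g (x - y))"
      using g by (subst (asm) d[symmetric, of]) (simp add: integrable_distr_eq)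
    show "(\<integral>y. norm (g (x - y)) \<partial>lborel) = (\<integral>y. norm (g y) \<partial>lborel)"
      by (subst (2) d[symmetric]) (simp add: integral_distr)
  qed
  have "integrable (lborel \<Otimes>\<^sub>M lborel) (\<lambda>(x, y). f' x * g (x - y))"
    by (rule lborel_pair.Fubini_integrable)
       (use gt if' in \<open>auto simp: abs_mult intro!: integrable_mult_left integrable_mult_right\<close>)
  hence "integrable lborel (\<lambda>(x, y). f' x * g (x - y))" by (simp add: lborel_prod)
  hence i: "integrable lebesgue (\<lambda>(x, y). f' x * g (x - y))"
    by (subst integrable_completion) (auto simp: borel_measurable_integrable)
  have ae: "AE z in (lebesgue :: ('a \<times> 'a) measure). f (fst z) = f' (fst z) \<and> f (snd z) = f' (snd z)"
    using eq by (intro AE_lebesgue_fst_snd) (auto simp: AE_completion_iff)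
  hence ae': "AE z in (lebesgue :: ('a \<times> 'a) measure). (\<lambda>(x, y). f' x * g (x - y)) z = (\<lambda>(x, y). f x * g (x - y)) z"
    by eventually_elim auto
  show ?thesis
    using i ae' borel_measurable_AE[OF borel_measurable_integrable[OF i] ae']
    by (subst integrable_cong_AE[where g="\<lambda>(x, y). f' x * g (x - y)"]) (auto elim: eventually_mono)
qed


section \<open>The energy identity\<close>

definition ball_cutoff :: "nat \<Rightarrow> 'a::euclidean_space \<Rightarrow> real" where
  "ball_cutoff n x = max 0 (min 1 (real n - norm x))"

lemma ball_cutoff_bounds: "0 \<le> ball_cutoff n x" "ball_cutoff n x \<le> 1"
  by (auto simp: ball_cutoff_def)

lemma ball_cutoff_diff: "\<bar>ball_cutoff n x - ball_cutoff n y\<bar> \<le> min 1 (norm (x - y))"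
  using norm_triangle_ineq3[of x y] by (auto simp: ball_cutoff_def)

lemma ball_cutoff_outside: "x \<notin> cball 0 (real n) \<Longrightarrow> ball_cutoff n x = 0"
  by (auto simp: ball_cutoff_def)

lemma ball_cutoff_tendsto: "(\<lambda>n. ball_cutoff n x) \<longlonglongrightarrow> 1"
proof (rule tendsto_eventually)
  obtain m :: nat where "norm x + 1 \<le> real m" using real_arch_simple by blast
  hence "ball_cutoff n x = 1" if "n \<ge> m" for n
    using of_nat_mono[OF that, where 'a=real] unfolding ball_cutoff_def by linarith
  thus "\<forall>\<^sub>F n in sequentially. ball_cutoff n x = 1"
    by (auto simp: eventually_sequentially)
qed

lemma ball_cutoff_measurable [measurable]: "ball_cutoff n \<in> borel_measurable borel"
  unfolding ball_cutoff_def by measurable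

text \<open>
  Product rule for increments. The bound does not depend on \<open>n\<close>, so it serves for admissibility
  and for domination.
\<close>

lemma cutoff_increment_le:
  "\<bar>u x * ball_cutoff n x - u y * ball_cutoff n y\<bar> \<le> \<bar>u x - u y\<bar> + \<bar>u x\<bar> * min 1 (norm (x - y))"
proof -
  have "u x * ball_cutoff n x - u y * ball_cutoff n y =
      u x * (ball_cutoff n x - ball_cutoff n y) + (u x - u y) * ball_cutoff n y"
    by (simp add: algebra_simps)
  also have "\<bar>\<dots>\<bar> \<le> \<bar>u x\<bar> * \<bar>ball_cutoff n x - ball_cutoff n y\<bar> + \<bar>u x - u y\<bar> * \<bar>ball_cutoff n y\<bar>"
    by (metis abs_triangle_ineq abs_mult)
  also have "\<dots> \<le> \<bar>u x\<bar> * min 1 (norm (x - y)) + \<bar>u x - u y\<bar> * 1"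
    using ball_cutoff_bounds[of n y]
    by (intro add_mono mult_left_mono ball_cutoff_diff) auto
  finally show ?thesis by simp
qed

text \<open>
  A substitute for Young's inequality: the product is at most \<open>max a b powr p\<close>.
\<close>

lemma powr_mult_le_add_powr:
  fixes a b p :: real
  assumes "0 \<le> a" "0 \<le> b" "1 < p"
  shows "a powr (p - 1) * b \<le> a powr p + b powr p"
proof (cases "b \<le> a")
  case True
  have "a powr (p - 1) * b \<le> a powr (p - 1) * a" using True by (intro mult_left_mono) auto
  also have "\<dots> = a powr p" using assms by (cases "a = 0") (auto simp: powr_diff)
  finally show ?thesis using powr_ge_zero[of b p] by linarith
next
  case False
  have "a powr (p - 1) * b \<le> b powr (p - 1) * b"
    using False assms by (intro mult_right_mono powr_mono2) auto
  also have "\<dots> = b powr p" using assms by (cases "b = 0") (auto simp: powr_diff)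
  finally show ?thesis using powr_ge_zero[of a p] by linarith
qed

lemma add_powr_le:
  fixes a b p :: real
  assumes "0 \<le> a" "0 \<le> b" "0 \<le> p"
  shows "(a + b) powr p \<le> 2 powr p * (a powr p + b powr p)"
proof -
  have "(a + b) powr p \<le> (2 * max a b) powr p" using assms by (intro powr_mono2) auto
  also have "\<dots> = 2 powr p * max a b powr p" using assms by (simp add: powr_mult)
  also have "\<dots> \<le> 2 powr p * (a powr p + b powr p)" by (intro mult_left_mono) (auto simp: max_def)
  finally show ?thesis .
qed

lemma abs_J: "\<bar>J p \<tau>\<bar> = \<bar>\<tau>\<bar> powr (p - 1)"
  by (cases "\<tau> = 0") (simp_all add: J_def abs_mult powr_mult_base mult.commute)

lemma J_mult_self: "J p \<tau> * \<tau> = \<bar>\<tau>\<bar> powr p"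
  by (cases "\<tau> = 0") (auto simp: J_def powr_diff field_simps power2_eq_square abs_mult_self_eq)

definition energy_density :: "real \<Rightarrow> real \<Rightarrow> ('a::euclidean_space \<Rightarrow> real) \<Rightarrow> 'a \<times> 'a \<Rightarrow> real" where
  "energy_density s p u = (\<lambda>(x, y). \<bar>u x - u y\<bar> powr p / norm (x - y) powr (real DIM('a) + s * p))"

definition cutoff_error_density :: "real \<Rightarrow> real \<Rightarrow> ('a::euclidean_space \<Rightarrow> real) \<Rightarrow> 'a \<times> 'a \<Rightarrow> real" where
  "cutoff_error_density s p u =
    (\<lambda>(x, y). (\<bar>u x\<bar> * min 1 (norm (x - y))) powr p / norm (x - y) powr (real DIM('a) + s * p))"

lemma frac_sobolev_UNIV_iff:
  fixes u :: "'a::euclidean_space \<Rightarrow> real"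
  shows "u \<in> frac_sobolev UNIV s p \<longleftrightarrow> u \<in> borel_measurable lebesgue \<and>
     integrable lebesgue (\<lambda>x. \<bar>u x\<bar> powr p) \<and> integrable lebesgue (energy_density s p u)"
  by (simp add: frac_sobolev_def lebesgue_on_UNIV_eq set_integrable_def energy_density_def)

text \<open>
  This is where \<open>u\<close> has to be \<open>p\<close>-integrable over the whole space.
\<close>

lemma integrable_cutoff_error_density:
  fixes u :: "'a::euclidean_space \<Rightarrow> real"
  assumes "0 < s" "s < 1" "0 < p" "integrable lebesgue (\<lambda>x. \<bar>u x\<bar> powr p)"
  shows "integrable lebesgue (cutoff_error_density s p u)"
proof -
  have "cutoff_error_density s p u = (\<lambda>(x, y). \<bar>u x\<bar> powr p *
      (min 1 (norm (x - y)) powr p / norm (x - y) powr (real DIM('a) + s * p)))"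
    by (auto simp: cutoff_error_density_def powr_mult fun_eq_iff)
  thus ?thesis
    using integrable_lebesgue_convolution_integrand[OF assms(4)
            integrable_cutoff_kernel[OF assms(1-3), where 'a='a]]
    by simp
qed

lemma form_integrand_measurable:
  fixes u v :: "'a::euclidean_space \<Rightarrow> real" and F :: "real \<Rightarrow> real \<Rightarrow> real"
  assumes "u \<in> borel_measurable lebesgue" "v \<in> borel_measurable lebesgue"
    and F: "(\<lambda>(a, b). F a b) \<in> borel_measurable borel"
  shows "(\<lambda>(x, y). F (u x - u y) (v x - v y) / norm (x - y) powr \<alpha>)
          \<in> borel_measurable (lebesgue :: ('a \<times> 'a) measure)"
proof -
  note [measurable] = lebesgue_measurable_fst_snd[OF assms(1)] lebesgue_measurable_fst_snd[OF assms(2)]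
  have "(\<lambda>z::'a\<times>'a. norm (fst z - snd z) powr \<alpha>) \<in> borel_measurable borel"
    unfolding borel_prod[symmetric] by measurable
  hence [measurable]: "(\<lambda>z::'a\<times>'a. norm (fst z - snd z) powr \<alpha>) \<in> borel_measurable lebesgue"
    by (intro measurable_completion) simp
  have "(\<lambda>z::'a\<times>'a. (u (fst z) - u (snd z), v (fst z) - v (snd z))) \<in> lebesgue \<rightarrow>\<^sub>M borel"
    unfolding borel_prod[symmetric] by measurable
  from measurable_compose[OF this F]
  have [measurable]: "(\<lambda>z::'a\<times>'a. F (u (fst z) - u (snd z)) (v (fst z) - v (snd z))) \<in> borel_measurable lebesgue"
    by simp
  have "(\<lambda>z::'a\<times>'a. F (u (fst z) - u (snd z)) (v (fst z) - v (snd z)) / norm (fst z - snd z) powr \<alpha>)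
          \<in> borel_measurable lebesgue"
    by measurable
  thus ?thesis by (simp add: case_prod_beta')
qed

lemma frac_sobolev_cutoff:
  fixes u :: "'a::euclidean_space \<Rightarrow> real"
  assumes sp: "0 < s" "s < 1" "0 < p" and u: "u \<in> frac_sobolev UNIV s p"
  shows "(\<lambda>x. u x * ball_cutoff n x) \<in> frac_sobolev UNIV s p"
proof -
  let ?v = "\<lambda>x. u x * ball_cutoff n x"
  note u' = u[unfolded frac_sobolev_UNIV_iff]
  have [measurable]: "ball_cutoff n \<in> borel_measurable (lebesgue :: 'a measure)"
    by (intro measurable_completion) simp
  have [measurable]: "u \<in> borel_measurable lebesgue" using u' by simp
  have meas: "?v \<in> borel_measurable lebesgue" by measurable
  have "integrable lebesgue (\<lambda>x. \<bar>?v x\<bar> powr p)"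
  proof (rule Bochner_Integration.integrable_bound)
    show "AE x in lebesgue. norm (\<bar>?v x\<bar> powr p) \<le> norm (\<bar>u x\<bar> powr p)"
      using sp by (auto simp: abs_mult ball_cutoff_bounds intro!: AE_I2 powr_mono2 mult_left_le)
  qed (use u' in auto)
  moreover have "integrable lebesgue (energy_density s p ?v)"
  proof (rule Bochner_Integration.integrable_bound)
    show "integrable lebesgue (\<lambda>z. 2 powr p * (energy_density s p u z + cutoff_error_density s p u z))"
      using u' integrable_cutoff_error_density[of s p u] sp by auto
    show "energy_density s p ?v \<in> borel_measurable lebesgue"
      unfolding energy_density_def
      by (rule form_integrand_measurable[OF meas meas, where F="\<lambda>a b. \<bar>a\<bar> powr p"])
         (simp add: borel_prod[symmetric])
    show "AE z in lebesgue. norm (energy_density s p ?v z)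
        \<le> norm (2 powr p * (energy_density s p u z + cutoff_error_density s p u z))"
    proof (rule AE_I2)
      fix z :: "'a \<times> 'a"
      obtain x y where z: "z = (x, y)" by (cases z)
      let ?k = "norm (x - y) powr (real DIM('a) + s * p)"
      have "\<bar>?v x - ?v y\<bar> powr p \<le> (\<bar>u x - u y\<bar> + \<bar>u x\<bar> * min 1 (norm (x - y))) powr p"
        using sp by (intro powr_mono2 cutoff_increment_le) auto
      also have "\<dots> \<le> 2 powr p * (\<bar>u x - u y\<bar> powr p + (\<bar>u x\<bar> * min 1 (norm (x - y))) powr p)"
        using sp by (intro add_powr_le) auto
      finally have "\<bar>?v x - ?v y\<bar> powr p / ?k
          \<le> 2 powr p * (\<bar>u x - u y\<bar> powr p + (\<bar>u x\<bar> * min 1 (norm (x - y))) powr p) / ?k"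
        by (rule divide_right_mono) simp
      thus "norm (energy_density s p ?v z)
        \<le> norm (2 powr p * (energy_density s p u z + cutoff_error_density s p u z))"
        by (simp add: z energy_density_def cutoff_error_density_def add_divide_distrib[symmetric])
    qed
  qed
  ultimately show ?thesis using meas by (simp add: frac_sobolev_UNIV_iff)
qed

lemma frac_form_self: "frac_form s p u u = integral\<^sup>L lebesgue (energy_density s p u)"
  by (simp add: frac_form_def energy_density_def J_mult_self)

lemma J_measurable [measurable]: "J p \<in> borel_measurable borel"
  unfolding J_def by measurable

text \<open>
  The integrands converge pointwise because the cutoffs are eventually 1 at each point. They are
  dominated by twice the energy density plus the cutoff error density: with \<open>a = \<bar>u x - u y\<bar>\<close> and
  \<open>b = \<bar>u x\<bar> * min 1 (norm (x - y))\<close>, one has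
  \<open>a powr (p - 1) * (a + b) \<le> 2 * a powr p + b powr p\<close>.
\<close>

lemma frac_form_cutoff_tendsto:
  fixes u :: "'a::euclidean_space \<Rightarrow> real"
  assumes sp: "0 < s" "s < 1" "1 < p" and u: "u \<in> frac_sobolev UNIV s p"
  shows "(\<lambda>n. frac_form s p u (\<lambda>x. u x * ball_cutoff n x)) \<longlonglongrightarrow> frac_form s p u u"
  unfolding frac_form_def
proof (rule integral_dominated_convergence)
  note u' = u[unfolded frac_sobolev_UNIV_iff]
  have [measurable]: "u \<in> borel_measurable lebesgue" using u' by simp
  have [measurable]: "ball_cutoff n \<in> borel_measurable (lebesgue :: 'a measure)" for n
    by (intro measurable_completion) simp
  have F: "(\<lambda>(a, b). J p a * b) \<in> borel_measurable borel"
    by (simp add: borel_prod[symmetric])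
  let ?\<alpha> = "real DIM('a) + s * p"
  show "(\<lambda>(x, y). J p (u x - u y) * (u x - u y) / norm (x - y) powr ?\<alpha>) \<in> borel_measurable lebesgue"
    by (rule form_integrand_measurable[OF _ _ F]) measurable
  show "(\<lambda>(x, y). J p (u x - u y) * (u x * ball_cutoff n x - u y * ball_cutoff n y)
      / norm (x - y) powr ?\<alpha>) \<in> borel_measurable lebesgue" for n
    by (rule form_integrand_measurable[OF _ _ F]) measurable
  show "integrable lebesgue (\<lambda>z. 2 * energy_density s p u z + cutoff_error_density s p u z)"
    using u' integrable_cutoff_error_density[of s p u] sp by auto
  show "AE z in lebesgue. (\<lambda>n. case z of (x, y) \<Rightarrow>
      J p (u x - u y) * (u x * ball_cutoff n x - u y * ball_cutoff n y) / norm (x - y) powr ?\<alpha>)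
      \<longlonglongrightarrow> (case z of (x, y) \<Rightarrow> J p (u x - u y) * (u x - u y) / norm (x - y) powr ?\<alpha>)"
  proof (rule AE_I2)
    fix z :: "'a \<times> 'a"
    obtain x y where z: "z = (x, y)" by (cases z)
    have "(\<lambda>n. J p (u x - u y) * (u x * ball_cutoff n x - u y * ball_cutoff n y) * inverse (norm (x - y) powr ?\<alpha>))
      \<longlonglongrightarrow> J p (u x - u y) * (u x * 1 - u y * 1) * inverse (norm (x - y) powr ?\<alpha>)"
      by (intro tendsto_intros ball_cutoff_tendsto)
    thus "(\<lambda>n. case z of (x, y) \<Rightarrow>
      J p (u x - u y) * (u x * ball_cutoff n x - u y * ball_cutoff n y) / norm (x - y) powr ?\<alpha>)
      \<longlonglongrightarrow> (case z of (x, y) \<Rightarrow> J p (u x - u y) * (u x - u y) / norm (x - y) powr ?\<alpha>)"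
      by (simp add: z divide_inverse)
  qed
  show "AE z in lebesgue. norm (case z of (x, y) \<Rightarrow>
      J p (u x - u y) * (u x * ball_cutoff n x - u y * ball_cutoff n y) / norm (x - y) powr ?\<alpha>)
      \<le> 2 * energy_density s p u z + cutoff_error_density s p u z" for n
  proof (rule AE_I2)
    fix z :: "'a \<times> 'a"
    obtain x y where z: "z = (x, y)" by (cases z)
    let ?a = "\<bar>u x - u y\<bar>" and ?b = "\<bar>u x\<bar> * min 1 (norm (x - y))"
    have "\<bar>J p (u x - u y) * (u x * ball_cutoff n x - u y * ball_cutoff n y)\<bar> \<le> ?a powr (p - 1) * (?a + ?b)"
      unfolding abs_mult abs_J by (intro mult_left_mono cutoff_increment_le) auto
    also have "\<dots> = J p (u x - u y) * (u x - u y) + ?a powr (p - 1) * ?b"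
      by (cases "?a = 0") (auto simp: J_mult_self powr_diff distrib_left)
    also have "\<dots> \<le> 2 * ?a powr p + ?b powr p"
      using powr_mult_le_add_powr[of ?a ?b p] sp by (simp add: J_mult_self)
    finally have "\<bar>J p (u x - u y) * (u x * ball_cutoff n x - u y * ball_cutoff n y)\<bar> / norm (x - y) powr ?\<alpha>
       \<le> (2 * ?a powr p + ?b powr p) / norm (x - y) powr ?\<alpha>"
      by (rule divide_right_mono) simp
    thus "norm (case z of (x, y) \<Rightarrow>
      J p (u x - u y) * (u x * ball_cutoff n x - u y * ball_cutoff n y) / norm (x - y) powr ?\<alpha>)
      \<le> 2 * energy_density s p u z + cutoff_error_density s p u z"
      by (simp add: z energy_density_def cutoff_error_density_def add_divide_distrib)
  qed
qed

text \<open>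
  A vanishing energy gives \<open>u x = u y\<close> for almost all pairs; by Fubini some fixed \<open>x\<close> satisfies this
  for almost all \<open>y\<close>, and its value is the constant.
\<close>

lemma AE_const_if_zero_energy:
  fixes u :: "'a::euclidean_space \<Rightarrow> real"
  assumes u: "u \<in> frac_sobolev UNIV s p" and 0: "integral\<^sup>L lebesgue (energy_density s p u) = 0"
  shows "\<exists>c. AE x in lebesgue. u x = c"
proof -
  note u' = u[unfolded frac_sobolev_UNIV_iff]
  have "AE z in lebesgue. energy_density s p u z = 0"
    using u' 0 by (subst (asm) integral_nonneg_eq_0_iff_AE) (auto simp: energy_density_def)
  \<comment> \<open>The density vanishes on the diagonal as well, but there \<open>u x = u y\<close> is trivial.\<close>
  hence eq: "AE z in (lebesgue :: ('a \<times> 'a) measure). u (fst z) = u (snd z)"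
    by eventually_elim (auto simp: energy_density_def split: prod.splits)
  obtain v where v: "v \<in> borel_measurable lborel" "AE x in lborel. u x = v x"
    using completion_ex_borel_measurable_real[of u lborel] u' by auto
  have [measurable]: "v \<in> borel_measurable borel" using v(1) by simp
  have "AE z in (lebesgue :: ('a \<times> 'a) measure). u (fst z) = v (fst z) \<and> u (snd z) = v (snd z)"
    using v(2) by (intro AE_lebesgue_fst_snd) (simp add: AE_completion_iff)
  with eq have "AE z in (lebesgue :: ('a \<times> 'a) measure). v (fst z) = v (snd z)"
    by eventually_elim auto
  hence "AE z in (lborel \<Otimes>\<^sub>M lborel :: ('a \<times> 'a) measure). v (fst z) = v (snd z)"
    unfolding lborel_prod by (simp add: AE_completion_iff)
  hence "AE x in lborel. AE y in lborel. v x = v y"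
    by (drule_tac lborel_pair.AE_pair) simp
  moreover have "\<not> (AE x in (lborel :: 'a measure). False)"
    by (simp add: AE_iff_measurable[where N=UNIV])
  ultimately obtain x where "AE y in (lborel :: 'a measure). v x = v y"
    by (metis (mono_tags, lifting) eventually_mono)
  with v(2) have "AE y in lborel. u y = v x" by eventually_elim simp
  thus ?thesis by (auto simp: AE_completion_iff)
qed

theorem corollary1p4:
  fixes u :: "'a::euclidean_space \<Rightarrow> real"
    and s t p q \<epsilon> \<beta> :: real
  assumes "0 < s" "s < 1" "0 < t" "t < 1" "1 < p" "1 < q"
    and "s * p / (p - 1) \<ge> t * q / (q - 1)"
    and "(q \<le> 2 \<and> 2 \<le> p) \<or> (p \<le> 2 \<and> 2 \<le> q \<and> s * p \<ge> t * q) \<or> (p \<le> 2 \<and> q \<le> 2)"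
    and "u \<in> frac_sobolev UNIV s p \<inter> tail_space (p - 1) (s * p)"
    and "u \<in> frac_sobolev UNIV t q \<inter> tail_space (q - 1) (t * q)"
    and "\<exists>B. AE x in lebesgue. \<bar>u x\<bar> \<le> B"
    and "local_weak_solution UNIV s p t q u"
    and "0 < \<epsilon>" "\<epsilon> < Gamma_exp s p"
    and "interior_holder_exponent TYPE('a) s p t q \<epsilon> \<beta>"
    and "\<beta> * (s * p - t * q) < Gamma_exp s p"
  shows "\<exists>c. AE x in lebesgue. u x = c"
proof -
  have u: "u \<in> frac_sobolev UNIV s p" "u \<in> frac_sobolev UNIV t q"
    using assms(9,10) by auto
  have "frac_form s p u (\<lambda>x. u x * ball_cutoff n x) + frac_form t q u (\<lambda>x. u x * ball_cutoff n x) = 0" for n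
  proof -
    have "(\<lambda>x. u x * ball_cutoff n x) \<in> frac_sobolev UNIV s p \<inter> frac_sobolev UNIV t q"
      using assms(1-6) u by (auto intro!: frac_sobolev_cutoff)
    moreover have "\<exists>K. compact K \<and> K \<subseteq> UNIV \<and> (\<forall>x. x \<notin> K \<longrightarrow> u x * ball_cutoff n x = 0)"
      by (intro exI[of _ "cball 0 (real n)"]) (auto simp: ball_cutoff_outside)
    ultimately show ?thesis
      using assms(12) unfolding local_weak_solution_def by (elim conjE) (drule (1) bspec, erule (1) mp)
  qed
  moreover have "(\<lambda>n. frac_form s p u (\<lambda>x. u x * ball_cutoff n x) + frac_form t q u (\<lambda>x. u x * ball_cutoff n x))
      \<longlonglongrightarrow> frac_form s p u u + frac_form t q u u"
    using assms(1-6) u by (intro tendsto_add frac_form_cutoff_tendsto)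
  ultimately have "frac_form s p u u + frac_form t q u u = 0"
    by (simp add: LIMSEQ_const_iff)
  moreover have "0 \<le> integral\<^sup>L lebesgue (energy_density s p u)" "0 \<le> integral\<^sup>L lebesgue (energy_density t q u)"
    by (auto intro!: integral_nonneg_AE AE_I2 simp: energy_density_def)
  ultimately have "integral\<^sup>L lebesgue (energy_density s p u) = 0"
    by (simp add: frac_form_self)
  with u(1) show ?thesis by (rule AE_const_if_zero_energy)
qed

end
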